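(* Let $r\ge 2$ be an even integer, let $M_r=\frac{r^2}{2r^2-2}$, and let $y$ be a random variable uniformly distributed on $[0,M_r]$. Then the expected cardinality of the level set $L_r(y)$ is infinite. That is, $$\mathbb{E}\big[\mathrm{card}(L_r(y))\big]=\frac{2r^2-2}{r^2}\int_0^{\frac{r^2}{2r^2-2}}\mathrm{card}(L_r(y))\,dy=\infty.$$
   Context: The Takagi-van der Waerden function is $T_r(x)=\sum_{n=0}^\infty \frac{\phi(r^n x)}{r^n}$ for $x\in[0,1]$, where $\phi(x)=\mathrm{dist}(x,\mathbb{Z})$ is the distance from $x$ to the nearest integer. For $y\in\mathbb{R}$ the level set is $L_r(y)=\{x\in[0,1]: T_r(x)=y\}$. For even $r\ge2$, $M_r=\frac{r^2}{2r^2-2}$ is the maximum value of $T_r$. $\mathrm{card}$ denotes cardinality, with values in $\{0,1,2,\dots\}\cup\{\infty\}$. *)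

theory Defs
  imports "HOL-Probability.Probability"
begin

definition dist_int :: "real \<Rightarrow> real" where
  "dist_int x = infdist x \<int>"

definition takagi :: "nat \<Rightarrow> real \<Rightarrow> real" where
  "takagi r x = (\<Sum>n. dist_int (real r ^ n * x) / real r ^ n)"

definition level_set :: "nat \<Rightarrow> real \<Rightarrow> real set" where
  "level_set r y = {x \<in> {0..1}. takagi r x = y}"

definition takagi_max :: "nat \<Rightarrow> real" where
  "takagi_max r = (real r)\<^sup>2 / (2 * (real r)\<^sup>2 - 2)"

text \<open>Cardinality with values in \<open>{0, 1, 2, \<dots>} \<union> {\<infinity>}\<close>; the library's \<^const>\<open>card\<close>
  is \<open>0\<close> on infinite sets.\<close>

definition ext_card :: "'a set \<Rightarrow> ennreal" where
  "ext_card A = (if finite A then of_nat (card A) else \<infinity>)"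

end

theory Submission
  imports Defs
begin

text \<open>
  Write \<open>T\<close> for the function \<open>takagi r\<close>. By Banach's indicatrix theorem, the integral over all
  \<open>y\<close> of the number of solutions of \<open>T x = y\<close> in the unit interval is the total variation of \<open>T\<close>
  there. Only one inequality is needed: the integral is at least every variation sum
  (\<open>variation_le_integral_indicatrix\<close>). It therefore suffices that \<open>T\<close> has unbounded variation and
  that its values lie in \<open>[0, takagi_max r]\<close> (\<open>takagi_nonneg\<close>, \<open>takagi_le_max\<close>), so that
  restricting the integral to this interval loses nothing.

  Unbounded variation comes from a random walk. The identity \<open>T x = dist_int x + T (r x) / r\<close> and the
  periodicity of \<open>T\<close> show that the slopes of the chords of \<open>T\<close> over the intervals
  \<open>[i / r ^ n, (i + 1) / r ^ n]\<close> arise from those of level \<open>n - 1\<close> by adding \<open>1\<close> for half of the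
  possible values of the leading base \<open>r\<close> digit of \<open>i\<close> and \<open>-1\<close> for the other half
  (\<open>chord_slope_Suc\<close>; this uses that \<open>r\<close> is even). Hence, for a uniformly random \<open>i < r ^ n\<close>, the slope
  is distributed as a simple random walk after \<open>n\<close> steps, and the variation sum over the partition
  is the mean of its absolute value. The second moment of the walk is \<open>n\<close> and its fourth moment is
  at most \<open>3 n\<^sup>2\<close>, so this mean is at least a constant times the square root of \<open>n\<close>
  (\<open>takagi_variation\<close>).

  For the indicatrix, the cardinality of a level set is the supremum over \<open>n\<close> of the number of
  intervals of length \<open>1 / n\<close> that it meets (\<open>ext_card_eq_SUP_floor\<close>). That number is a finite sum of
  indicators of images of intervals under a continuous function, which are intervals again. This
  gives Borel measurability, and integrating the sum of indicators gives the sum of the lengths of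
  the images, which dominates the variation sum.
\<close>

section \<open>The distance to the nearest integer\<close>

lemma dist_int_frac: "dist_int x = min (frac x) (1 - frac x)"
proof (rule antisym)
  have "dist_int x \<le> dist x (of_int \<lfloor>x\<rfloor>)" "dist_int x \<le> dist x (of_int (\<lfloor>x\<rfloor> + 1))"
    unfolding dist_int_def by (intro infdist_le Ints_of_int)+
  moreover have "dist x (of_int \<lfloor>x\<rfloor>) = frac x" "dist x (of_int (\<lfloor>x\<rfloor> + 1)) = 1 - frac x"
    unfolding dist_real_def frac_def by linarith+
  ultimately show "dist_int x \<le> min (frac x) (1 - frac x)"
    by simp
next
  have ne: "(\<int> :: real set) \<noteq> {}"
    using Ints_0 by blast
  show "min (frac x) (1 - frac x) \<le> dist_int x"
    unfolding dist_int_def infdist_notempty[OF ne]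
  proof (rule cINF_greatest[OF ne])
    fix a :: real assume "a \<in> \<int>"
    then obtain k where k: "a = of_int k"
      by (auto elim: Ints_cases)
    have "k \<le> \<lfloor>x\<rfloor> \<or> k \<ge> \<lfloor>x\<rfloor> + 1"
      by linarith
    then show "min (frac x) (1 - frac x) \<le> dist x a"
      unfolding k dist_real_def frac_def
    proof
      assume "k \<le> \<lfloor>x\<rfloor>"
      then have "real_of_int k \<le> of_int \<lfloor>x\<rfloor>" by linarith
      then show "min (x - of_int \<lfloor>x\<rfloor>) (1 - (x - of_int \<lfloor>x\<rfloor>)) \<le> \<bar>x - of_int k\<bar>"
        by linarith
    next
      assume "\<lfloor>x\<rfloor> + 1 \<le> k"
      then have "of_int \<lfloor>x\<rfloor> + 1 \<le> real_of_int k" by linarith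
      then show "min (x - of_int \<lfloor>x\<rfloor>) (1 - (x - of_int \<lfloor>x\<rfloor>)) \<le> \<bar>x - of_int k\<bar>"
        by linarith
    qed
  qed
qed

lemma dist_int_nonneg: "0 \<le> dist_int x"
  unfolding dist_int_def by (rule infdist_nonneg)

lemma dist_int_le_half: "dist_int x \<le> 1 / 2"
  unfolding dist_int_frac by linarith

lemma dist_int_add_of_nat: "dist_int (x + of_nat k) = dist_int x"
proof -
  have "frac (x + of_int (int k)) = frac x"
    unfolding frac_def by simp
  then show ?thesis
    unfolding dist_int_frac by simp
qed

lemma dist_int_left_half: "0 \<le> x \<Longrightarrow> x \<le> 1 / 2 \<Longrightarrow> dist_int x = x"
proof -
  assume x: "0 \<le> x" "x \<le> 1 / 2"
  then have "frac x = x" by (simp add: frac_eq)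
  with x show ?thesis by (simp add: dist_int_frac)
qed

lemma dist_int_right_half: "1 / 2 \<le> x \<Longrightarrow> x \<le> 1 \<Longrightarrow> dist_int x = 1 - x"
proof (cases "x = 1")
  case True
  then show ?thesis by (simp add: dist_int_frac)
next
  case False
  assume x: "1 / 2 \<le> x" "x \<le> 1"
  with False have "frac x = x" by (simp add: frac_eq)
  with x show ?thesis by (simp add: dist_int_frac)
qed

text \<open>
  For even \<open>r\<close> the midpoint between two consecutive integers is a multiple of \<open>1 / r\<close>. So the
  second summand is at most the distance from \<open>x\<close> to that midpoint, and this distance is exactly what
  the first summand lacks from \<open>1 / 2\<close>.
\<close>

lemma dist_int_add_rescaled_le:
  fixes r :: nat
  assumes "r > 0" "even r"
  shows "dist_int x + dist_int (real r * x) / real r \<le> 1 / 2"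
proof -
  obtain h where h: "r = 2 * h" using \<open>even r\<close> by (elim evenE)
  have "dist_int (real r * x) \<le> dist (real r * x) (of_int (int r * \<lfloor>x\<rfloor> + int h))"
    unfolding dist_int_def by (intro infdist_le Ints_of_int)
  also have "real r * x - of_int (int r * \<lfloor>x\<rfloor> + int h) = real r * (frac x - 1 / 2)"
    by (simp add: h frac_def algebra_simps)
  then have "dist (real r * x) (of_int (int r * \<lfloor>x\<rfloor> + int h)) = real r * \<bar>frac x - 1 / 2\<bar>"
    by (simp add: dist_real_def abs_mult)
  finally have "dist_int (real r * x) / real r \<le> \<bar>frac x - 1 / 2\<bar>"
    using \<open>r > 0\<close> by (simp add: field_simps)
  moreover have "dist_int x = 1 / 2 - \<bar>frac x - 1 / 2\<bar>"
    unfolding dist_int_frac by linarith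
  ultimately show ?thesis by linarith
qed

section \<open>Self-similarity, continuity and range of the Takagi-van der Waerden function\<close>

lemma takagi_term_bound:
  "norm (dist_int (real r ^ n * x) / real r ^ n) \<le> (1 / 2) * (1 / real r) ^ n"
proof -
  have "\<bar>dist_int (real r ^ n * x)\<bar> / real r ^ n \<le> (1 / 2) / real r ^ n"
    using dist_int_nonneg dist_int_le_half by (intro divide_right_mono) auto
  then show ?thesis by (simp add: power_divide)
qed

lemma summable_takagi_bound:
  assumes "r \<ge> 2"
  shows "summable (\<lambda>n. (1 / 2) * (1 / real r) ^ n)"
  using assms by (intro summable_mult summable_geometric) simp

lemma summable_takagi:
  assumes "r \<ge> 2"
  shows "summable (\<lambda>n. dist_int (real r ^ n * x) / real r ^ n)"
  by (rule summable_comparison_test'[OF summable_takagi_bound[OF assms] takagi_term_bound])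

lemma continuous_on_takagi:
  assumes "r \<ge> 2"
  shows "continuous_on A (takagi r)"
proof -
  have "uniform_limit A (\<lambda>n x. \<Sum>i<n. dist_int (real r ^ i * x) / real r ^ i)
      (\<lambda>x. \<Sum>i. dist_int (real r ^ i * x) / real r ^ i) sequentially"
    by (rule Weierstrass_m_test[OF takagi_term_bound summable_takagi_bound[OF assms]])
  moreover have "continuous_on A (\<lambda>x. \<Sum>i<n. dist_int (real r ^ i * x) / real r ^ i)" for n
    using assms unfolding dist_int_def by (intro continuous_intros) auto
  ultimately have "continuous_on A (\<lambda>x. \<Sum>i. dist_int (real r ^ i * x) / real r ^ i)"
    by (intro uniform_limit_theorem[OF always_eventually]) auto
  then show ?thesis
    by (simp add: takagi_def[abs_def])
qed

text \<open>
  The functional equation carries both the bound on the range and the recursion for the chord slopes.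
\<close>

lemma takagi_rescale:
  assumes "r \<ge> 2"
  shows "takagi r x = dist_int x + takagi r (real r * x) / real r"
proof -
  have "takagi r x = dist_int x + (\<Sum>n. dist_int (real r ^ Suc n * x) / real r ^ Suc n)"
    unfolding takagi_def using suminf_split_head[OF summable_takagi[OF assms, of x]] by simp
  also have "(\<Sum>n. dist_int (real r ^ Suc n * x) / real r ^ Suc n)
      = (\<Sum>n. dist_int (real r ^ n * (real r * x)) / real r ^ n / real r)"
    by (simp add: mult_ac)
  also have "\<dots> = takagi r (real r * x) / real r"
    unfolding takagi_def by (rule suminf_divide[OF summable_takagi[OF assms]])
  finally show ?thesis .
qed

lemma takagi_add_of_nat: "takagi r (x + of_nat k) = takagi r x"
proof -
  have "dist_int (real r ^ n * (x + of_nat k)) = dist_int (real r ^ n * x)" for n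
    using dist_int_add_of_nat[of "real r ^ n * x" "r ^ n * k"] by (simp add: distrib_left)
  then show ?thesis by (simp add: takagi_def)
qed

lemma takagi_nonneg:
  assumes "r \<ge> 2"
  shows "0 \<le> takagi r x"
  unfolding takagi_def
  by (intro suminf_nonneg summable_takagi[OF assms] divide_nonneg_nonneg dist_int_nonneg) auto

text \<open>
  Two rescalings express \<open>T x\<close> as two terms of total size at most \<open>1 / 2\<close> plus
  \<open>T (r\<^sup>2 x) / r\<^sup>2\<close>. The supremum \<open>S\<close> of \<open>T\<close> over the whole real line hence satisfies
  \<open>S \<le> 1 / 2 + S / r\<^sup>2\<close>, which is equivalent to \<open>S \<le> takagi_max r\<close>. Taking the supremum over the
  whole line makes room for the rescaled argument, which leaves the unit interval.
\<close>

lemma takagi_le_max: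
  assumes "r \<ge> 2" "even r"
  shows "takagi r x \<le> takagi_max r"
proof -
  define S where "S = (SUP x. takagi r x)"
  have "takagi r x \<le> (\<Sum>n. (1 / 2) * (1 / real r) ^ n)" for x
    unfolding takagi_def using takagi_term_bound[of r _ x]
    by (intro suminf_le summable_takagi summable_takagi_bound assms) (metis abs_le_D1 real_norm_def)
  then have bdd: "bdd_above (range (takagi r))"
    by (auto intro!: bdd_aboveI2)
  have "takagi r x \<le> 1 / 2 + S / (real r)\<^sup>2" for x
  proof -
    have "takagi r x = dist_int x + dist_int (real r * x) / real r
        + takagi r (real r * (real r * x)) / (real r)\<^sup>2"
      using takagi_rescale[OF assms(1), of x] takagi_rescale[OF assms(1), of "real r * x"]
      by (simp add: add_divide_distrib power2_eq_square)
    moreover have "takagi r (real r * (real r * x)) / (real r)\<^sup>2 \<le> S / (real r)\<^sup>2"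
      unfolding S_def by (intro divide_right_mono cSUP_upper bdd) auto
    moreover have "dist_int x + dist_int (real r * x) / real r \<le> 1 / 2"
      using assms by (intro dist_int_add_rescaled_le) auto
    ultimately show ?thesis by linarith
  qed
  then have "S \<le> 1 / 2 + S / (real r)\<^sup>2"
    unfolding S_def by (intro cSUP_least) auto
  moreover have "(real r)\<^sup>2 > 1"
    using assms(1) by (simp add: power2_eq_square less_1_mult)
  moreover have "S * (real r)\<^sup>2 \<le> (1 / 2 + S / (real r)\<^sup>2) * (real r)\<^sup>2"
    using \<open>S \<le> 1 / 2 + S / (real r)\<^sup>2\<close> by (intro mult_right_mono) auto
  ultimately have "S \<le> takagi_max r"
    using assms(1) by (simp add: takagi_max_def pos_le_divide_eq algebra_simps)
  moreover have "takagi r x \<le> S"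
    unfolding S_def by (intro cSUP_upper bdd) auto
  ultimately show ?thesis by linarith
qed

section \<open>Unbounded variation\<close>

definition chord_slope :: "nat \<Rightarrow> nat \<Rightarrow> nat \<Rightarrow> real" where
  "chord_slope r n i = real r ^ n * (takagi r (real (Suc i) / real r ^ n) - takagi r (real i / real r ^ n))"

text \<open>
  The index \<open>q * r ^ n + i\<close> has leading digit \<open>q\<close> at level \<open>n + 1\<close>. Multiplication by \<open>r\<close> maps its
  interval onto the translate by \<open>q\<close> of the \<open>i\<close>-th interval of level \<open>n\<close>, which accounts for
  \<open>chord_slope r n i\<close> by periodicity. Since \<open>r\<close> is even, the interval does not cross the point \<open>1 / 2\<close>, so
  \<open>dist_int\<close> is affine on it, with slope \<open>1\<close> to the left of \<open>1 / 2\<close> and \<open>-1\<close> to the right.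
\<close>

lemma chord_slope_Suc:
  assumes "r = 2 * h" "h > 0" "q < r" "i < r ^ n"
  shows "chord_slope r (Suc n) (q * r ^ n + i) = chord_slope r n i + (if q < h then 1 else -1)"
proof -
  have r2: "r \<ge> 2" using assms by simp
  then have rpos: "real r > 0" by simp
  have resc: "takagi r (real (q * r ^ n + k) / real r ^ Suc n)
      = dist_int (real (q * r ^ n + k) / real r ^ Suc n) + takagi r (real k / real r ^ n) / real r" for k
  proof -
    have "real r * (real (q * r ^ n + k) / real r ^ Suc n) = real k / real r ^ n + of_nat q"
      using rpos by (simp add: field_simps)
    then show ?thesis
      by (subst takagi_rescale[OF r2]) (simp only: takagi_add_of_nat)
  qed
  define u where "u k = real (q * r ^ n + k) / real r ^ Suc n" for k
  have diff: "u (Suc i) = u i + 1 / real r ^ Suc n"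
    by (simp add: u_def add_divide_distrib)
  have "chord_slope r (Suc n) (q * r ^ n + i)
      = chord_slope r n i + real r ^ Suc n * (dist_int (u (Suc i)) - dist_int (u i))"
    unfolding chord_slope_def u_def add_Suc_right[symmetric] resc using rpos
    by (simp add: field_simps)
  moreover have "dist_int (u (Suc i)) - dist_int (u i) = (if q < h then 1 else -1) / real r ^ Suc n"
  proof (cases "q < h")
    case True
    have "q * r ^ n + Suc i \<le> Suc q * r ^ n" using assms(4) by simp
    also have "\<dots> \<le> h * r ^ n" using True by (intro mult_right_mono) auto
    finally have "2 * (q * r ^ n + Suc i) \<le> r ^ Suc n" by (simp add: assms(1))
    then have "2 * real (q * r ^ n + Suc i) \<le> real r ^ Suc n"
      by (metis of_nat_le_iff of_nat_mult of_nat_numeral of_nat_power)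
    then have "u (Suc i) \<le> 1 / 2"
      using rpos unfolding u_def by (simp add: divide_le_eq del: of_nat_add of_nat_Suc power_Suc)
    moreover have "0 \<le> u i" by (simp add: u_def)
    moreover have "u i \<le> u (Suc i)" using rpos by (simp add: diff)
    ultimately have "dist_int (u (Suc i)) = u (Suc i)" "dist_int (u i) = u i"
      by (intro dist_int_left_half; linarith)+
    then show ?thesis using True by (simp add: diff)
  next
    case False
    have "r ^ Suc n = 2 * (h * r ^ n)" by (simp add: assms(1))
    also have "\<dots> \<le> 2 * (q * r ^ n + i)"
      using False by (intro mult_left_mono trans_le_add1 mult_right_mono) auto
    finally have "real r ^ Suc n \<le> 2 * real (q * r ^ n + i)"
      by (metis of_nat_le_iff of_nat_mult of_nat_numeral of_nat_power)
    then have ge: "1 / 2 \<le> u i"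
      using rpos unfolding u_def by (simp add: le_divide_eq del: of_nat_add of_nat_Suc power_Suc)
    have "q * r ^ n + Suc i \<le> Suc q * r ^ n" using assms(4) by simp
    also have "\<dots> \<le> r * r ^ n" using assms(3) by (intro mult_right_mono) auto
    finally have "real (q * r ^ n + Suc i) \<le> real r ^ Suc n"
      by (metis of_nat_le_iff of_nat_power power_Suc)
    then have "u (Suc i) \<le> 1"
      using rpos unfolding u_def by (simp add: divide_le_eq del: of_nat_add of_nat_Suc power_Suc)
    moreover have "u i \<le> u (Suc i)" using rpos by (simp add: diff)
    ultimately have "dist_int (u (Suc i)) = 1 - u (Suc i)" "dist_int (u i) = 1 - u i"
      using ge by (intro dist_int_right_half; linarith)+
    then show ?thesis using False by (simp add: diff)
  qed
  ultimately show ?thesis using rpos by simp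
qed

text \<open>
  The step of the random walk: up to the normalising factor \<open>r ^ n\<close>, it relates the mean of \<open>F\<close> at
  time \<open>n + 1\<close> to means at time \<open>n\<close>, and yields recursions for all moments.
\<close>

lemma sum_chord_slope_Suc:
  fixes F :: "real \<Rightarrow> real"
  assumes "r = 2 * h" "h > 0"
  shows "(\<Sum>j<r ^ Suc n. F (chord_slope r (Suc n) j))
    = real h * (\<Sum>i<r ^ n. F (chord_slope r n i + 1) + F (chord_slope r n i - 1))"
proof -
  have "(\<Sum>j<r ^ Suc n. F (chord_slope r (Suc n) j))
      = (\<Sum>q<r. \<Sum>j\<in>{q * r ^ n..<q * r ^ n + r ^ n}. F (chord_slope r (Suc n) j))"
    by (simp only: sum.nat_group power_Suc)
  also have "\<dots> = (\<Sum>q<r. \<Sum>i<r ^ n. F (chord_slope r (Suc n) (q * r ^ n + i)))"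
    using sum.shift_bounds_nat_ivl[of "\<lambda>j. F (chord_slope r (Suc n) j)" 0 "_ * r ^ n" "r ^ n"]
    by (simp add: atLeast0LessThan add.commute)
  also have "\<dots> = (\<Sum>q<r. \<Sum>i<r ^ n. F (chord_slope r n i + (if q < h then 1 else -1)))"
    by (intro sum.cong refl) (simp add: chord_slope_Suc[OF assms])
  also have "\<dots> = (\<Sum>i<r ^ n. \<Sum>q<h + h. F (chord_slope r n i + (if q < h then 1 else -1)))"
    unfolding assms(1) mult_2 by (rule sum.swap)
  also have "\<dots> = (\<Sum>i<r ^ n. real h * (F (chord_slope r n i + 1) + F (chord_slope r n i - 1)))"
  proof (intro sum.cong refl)
    fix i
    let ?g = "\<lambda>q. F (chord_slope r n i + (if q < h then 1 else -1))"
    have "(\<Sum>q<h + h. ?g q) = (\<Sum>q=0..<h. ?g q) + (\<Sum>q=h..<h + h. ?g q)"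
      unfolding lessThan_atLeast0 by (intro sum.atLeastLessThan_concat[symmetric]) auto
    also have "(\<Sum>q=0..<h. ?g q) = (\<Sum>q=0..<h. F (chord_slope r n i + 1))"
      by (intro sum.cong) auto
    also have "(\<Sum>q=h..<h + h. ?g q) = (\<Sum>q=h..<h + h. F (chord_slope r n i - 1))"
      by (intro sum.cong) auto
    finally show "(\<Sum>q<h + h. ?g q) = real h * (F (chord_slope r n i + 1) + F (chord_slope r n i - 1))"
      by (simp add: algebra_simps)
  qed
  finally show ?thesis by (simp only: sum_distrib_left)
qed

lemma sum_chord_slope_square:
  assumes "r = 2 * h" "h > 0"
  shows "(\<Sum>j<r ^ n. (chord_slope r n j)\<^sup>2) = real n * real r ^ n"
proof (induction n)
  case 0
  have "takagi r 1 = takagi r 0" using takagi_add_of_nat[of r 0 1] by simp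
  then show ?case by (simp add: chord_slope_def)
next
  case (Suc n)
  have *: "(a + 1)\<^sup>2 + (a - 1)\<^sup>2 = 2 * a\<^sup>2 + 2" for a :: real
    by (simp add: power2_eq_square algebra_simps)
  show ?case
    unfolding sum_chord_slope_Suc[OF assms, of "\<lambda>a. a\<^sup>2"] * sum.distrib sum_distrib_left[symmetric] Suc.IH
    by (simp add: assms(1) algebra_simps)
qed

lemma sum_chord_slope_fourth:
  assumes "r = 2 * h" "h > 0"
  shows "(\<Sum>j<r ^ n. (chord_slope r n j) ^ 4) \<le> 3 * (real n)\<^sup>2 * real r ^ n"
proof (induction n)
  case 0
  have "takagi r 1 = takagi r 0" using takagi_add_of_nat[of r 0 1] by simp
  then show ?case by (simp add: chord_slope_def)
next
  case (Suc n)
  have *: "(a + 1) ^ 4 + (a - 1) ^ 4 = 2 * a ^ 4 + (12 * a\<^sup>2 + 2)" for a :: real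
    by (simp add: power4_eq_xxxx power2_eq_square algebra_simps)
  have "(\<Sum>j<r ^ Suc n. (chord_slope r (Suc n) j) ^ 4)
      = real h * (2 * (\<Sum>j<r ^ n. (chord_slope r n j) ^ 4) + (12 * (real n * real r ^ n) + 2 * real r ^ n))"
    unfolding sum_chord_slope_Suc[OF assms, of "\<lambda>a. a ^ 4"] * sum.distrib sum_distrib_left[symmetric]
      sum_chord_slope_square[OF assms] by simp
  also have "\<dots> \<le> real h * (2 * (3 * (real n)\<^sup>2 * real r ^ n)
      + (12 * (real n * real r ^ n) + 2 * real r ^ n))"
    by (intro mult_left_mono add_right_mono Suc.IH) auto
  also have "\<dots> = (3 * (real n)\<^sup>2 + 6 * real n + 1) * real r ^ Suc n"
    by (simp add: assms(1) algebra_simps)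
  also have "\<dots> \<le> 3 * (real (Suc n))\<^sup>2 * real r ^ Suc n"
    by (intro mult_right_mono) (auto simp: power2_eq_square algebra_simps)
  finally show ?case .
qed

text \<open>
  This bounds a first absolute moment from below by a second and a fourth moment. The constant
  \<open>4 / 27\<close> is the smallest possible one: both sides agree to first order at \<open>\<bar>a\<bar> = 3 * s / 2\<close>, which
  explains the factor \<open>(t - 3 / 2)\<^sup>2\<close> in the proof.
\<close>

lemma abs_ge_square_minus_fourth:
  fixes a s :: real
  assumes "s > 0"
  shows "a\<^sup>2 / s - 4 * a ^ 4 / (27 * s ^ 3) \<le> \<bar>a\<bar>"
proof -
  define t where "t = \<bar>a\<bar> / s"
  have t: "t \<ge> 0" "\<bar>a\<bar> = t * s" using assms by (auto simp: t_def)
  have a: "a\<^sup>2 = (t * s)\<^sup>2" "a ^ 4 = (t * s) ^ 4"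
    unfolding t(2)[symmetric] by (simp_all add: power_even_abs)
  have "\<bar>a\<bar> - (a\<^sup>2 / s - 4 * a ^ 4 / (27 * s ^ 3)) = 4 / 27 * (t * s * ((t - 3 / 2)\<^sup>2 * (t + 3)))"
    unfolding a t(2) using assms
    by (simp add: field_simps power2_eq_square power3_eq_cube power4_eq_xxxx)
  moreover have "0 \<le> t * s * ((t - 3 / 2)\<^sup>2 * (t + 3))"
    using t(1) assms by simp
  ultimately show ?thesis by linarith
qed

text \<open>
  The typical size of the slope at level \<open>n\<close> is the square root of \<open>n\<close>; levels \<open>n = m\<^sup>2\<close> turn this
  into the scale \<open>s = m\<close> in the preceding inequality. The mean of the absolute slope is then at least
  \<open>m - (4 / 27) * 3 * m = 5 * m / 9\<close>.
\<close>

lemma takagi_variation: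
  assumes "r = 2 * h" "h > 0" "m > 0"
  defines "n \<equiv> m\<^sup>2"
  shows "real m / 2 \<le> (\<Sum>j<r ^ n. \<bar>takagi r (real (Suc j) / real r ^ n) - takagi r (real j / real r ^ n)\<bar>)"
proof -
  have rn: "real r ^ n > 0" using assms by simp
  have m: "real m > 0" using assms by simp
  have n: "real n = (real m)\<^sup>2" by (simp add: n_def)
  have "real m / 2 * real r ^ n \<le> 5 / 9 * real m * real r ^ n"
    by (intro mult_right_mono) auto
  also have "\<dots>
      = (real n * real r ^ n) / real m - 4 * (3 * (real n)\<^sup>2 * real r ^ n) / (27 * real m ^ 3)"
    using m unfolding n by (simp add: field_simps power2_eq_square power3_eq_cube)
  also have "\<dots> \<le> (\<Sum>j<r ^ n. (chord_slope r n j)\<^sup>2) / real m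
      - 4 * (\<Sum>j<r ^ n. (chord_slope r n j) ^ 4) / (27 * real m ^ 3)"
    unfolding sum_chord_slope_square[OF assms(1,2)]
    by (intro diff_left_mono divide_right_mono mult_left_mono sum_chord_slope_fourth[OF assms(1,2)]) auto
  also have "\<dots> = (\<Sum>j<r ^ n. (chord_slope r n j)\<^sup>2 / real m - 4 * (chord_slope r n j) ^ 4 / (27 * real m ^ 3))"
    by (simp add: sum_subtractf sum_divide_distrib sum_distrib_left)
  also have "\<dots> \<le> (\<Sum>j<r ^ n. \<bar>chord_slope r n j\<bar>)"
    by (intro sum_mono abs_ge_square_minus_fourth m)
  also have "\<dots> = (\<Sum>j<r ^ n. \<bar>takagi r (real (Suc j) / real r ^ n) - takagi r (real j / real r ^ n)\<bar>)
      * real r ^ n"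
    unfolding chord_slope_def by (simp add: abs_mult sum_distrib_left mult.commute)
  finally show ?thesis
    using rn by simp
qed

section \<open>The Banach indicatrix\<close>

lemma card_image_le_ext_card: "of_nat (card (g ` A)) \<le> ext_card A"
  unfolding ext_card_def by (auto intro!: card_image_le)

lemma ennreal_eq_top_if_of_nat_le:
  fixes x :: ennreal
  assumes "\<And>k. of_nat k \<le> x"
  shows "x = top"
  using assms ennreal_Ex_less_of_nat[of x] by (metis leD top.not_eq_extremum)

text \<open>
  Two distinct points \<open>x < y\<close> lie in different cells of the grid as soon as
  \<open>b n \<ge> 1 / (y - x)\<close>. So any finite subset of \<open>A\<close> is eventually separated by the grid, and its
  cardinality is bounded by the number of cells that meet \<open>A\<close>.
\<close>

lemma ext_card_eq_SUP_floor:
  fixes A :: "real set" and b :: "nat \<Rightarrow> real"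
  assumes fin: "\<And>n. finite ((\<lambda>x. \<lfloor>b n * x\<rfloor>) ` A)"
    and b: "filterlim b at_top sequentially"
  shows "ext_card A = (SUP n. of_nat (card ((\<lambda>x. \<lfloor>b n * x\<rfloor>) ` A)))"
proof (rule antisym)
  have ge: "of_nat (card F) \<le> (SUP n. of_nat (card ((\<lambda>x. \<lfloor>b n * x\<rfloor>) ` A)) :: ennreal)"
    if F: "finite F" "F \<subseteq> A" for F
  proof -
    have "\<forall>\<^sub>F n in sequentially. \<forall>p\<in>F \<times> F. fst p < snd p \<longrightarrow> \<lfloor>b n * fst p\<rfloor> \<noteq> \<lfloor>b n * snd p\<rfloor>"
    proof (intro eventually_ball_finite ballI)
      fix p assume "p \<in> F \<times> F"
      have "\<forall>\<^sub>F n in sequentially. b n \<ge> 1 / (snd p - fst p)"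
        using b by (simp add: filterlim_at_top)
      then show "\<forall>\<^sub>F n in sequentially. fst p < snd p \<longrightarrow> \<lfloor>b n * fst p\<rfloor> \<noteq> \<lfloor>b n * snd p\<rfloor>"
      proof eventually_elim
        case (elim n)
        show ?case
        proof
          assume "fst p < snd p"
          with elim have "b n * snd p \<ge> b n * fst p + 1"
            by (simp add: field_simps)
          then show "\<lfloor>b n * fst p\<rfloor> \<noteq> \<lfloor>b n * snd p\<rfloor>"
            by linarith
        qed
      qed
    qed (use F in auto)
    then obtain n where n: "\<forall>p\<in>F \<times> F. fst p < snd p \<longrightarrow> \<lfloor>b n * fst p\<rfloor> \<noteq> \<lfloor>b n * snd p\<rfloor>"
      by (auto simp: eventually_sequentially)
    then have "inj_on (\<lambda>x. \<lfloor>b n * x\<rfloor>) F"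
      by (intro linorder_inj_onI') auto
    then have "card F = card ((\<lambda>x. \<lfloor>b n * x\<rfloor>) ` F)"
      by (simp add: card_image)
    also have "\<dots> \<le> card ((\<lambda>x. \<lfloor>b n * x\<rfloor>) ` A)"
      using F fin by (intro card_mono) auto
    finally have "(of_nat (card F) :: ennreal) \<le> of_nat (card ((\<lambda>x. \<lfloor>b n * x\<rfloor>) ` A))"
      by simp
    then show ?thesis
      by (rule order_trans) (rule SUP_upper, simp)
  qed
  show "ext_card A \<le> (SUP n. of_nat (card ((\<lambda>x. \<lfloor>b n * x\<rfloor>) ` A)))"
  proof (cases "finite A")
    case True
    then show ?thesis using ge[of A] by (simp add: ext_card_def)
  next
    case False
    have "of_nat k \<le> (SUP n. of_nat (card ((\<lambda>x. \<lfloor>b n * x\<rfloor>) ` A)) :: ennreal)" for k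
      using infinite_arbitrarily_large[OF False, of k] ge by metis
    then have "(SUP n. of_nat (card ((\<lambda>x. \<lfloor>b n * x\<rfloor>) ` A)) :: ennreal) = top"
      by (rule ennreal_eq_top_if_of_nat_le)
    then show ?thesis by (simp only: top_greatest)
  qed
  show "(SUP n. of_nat (card ((\<lambda>x. \<lfloor>b n * x\<rfloor>) ` A))) \<le> ext_card A"
    by (intro SUP_least card_image_le_ext_card)
qed

text \<open>
  For \<open>i < b\<close> this is the half-open interval \<open>[i / b, (i + 1) / b)\<close>, and for \<open>i = b\<close> it is the single
  point \<open>1\<close>. Half-open cells are disjoint, so counting the cells that meet a set never counts a
  point twice; the price is the additional index \<open>b\<close> in sums over all cells.
\<close>

definition cell :: "nat \<Rightarrow> nat \<Rightarrow> real set" where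
  "cell b i = {x \<in> {0..1}. \<lfloor>real b * x\<rfloor> = int i}"

lemma image_cell_borel:
  fixes f :: "real \<Rightarrow> real"
  assumes "continuous_on {0..1} f"
  shows "f ` cell b i \<in> sets borel"
proof -
  have "is_interval (cell b i)"
    unfolding is_interval_1 cell_def
  proof clarsimp
    fix x y z :: real
    assume "\<lfloor>real b * x\<rfloor> = int i" "\<lfloor>real b * y\<rfloor> = int i" and xyz: "x \<le> z" "z \<le> y"
    moreover have "\<lfloor>real b * x\<rfloor> \<le> \<lfloor>real b * z\<rfloor>" "\<lfloor>real b * z\<rfloor> \<le> \<lfloor>real b * y\<rfloor>"
      using xyz by (intro floor_mono mult_left_mono; simp)+
    ultimately show "\<lfloor>real b * z\<rfloor> = int i" by linarith
  qed
  then have "connected (cell b i)" by (simp add: is_interval_connected_1)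
  moreover have "continuous_on (cell b i) f"
    by (rule continuous_on_subset[OF assms]) (auto simp: cell_def)
  ultimately have "is_interval (f ` cell b i)"
    unfolding is_interval_connected_1 by (intro connected_continuous_image)
  then show ?thesis by (simp add: real_interval_borel_measurable)
qed

text \<open>
  By the intermediate value theorem on the closed interval, every value strictly between the values at
  the two end points is taken; it is not taken at the right end point, hence it is taken in the cell.
\<close>

lemma emeasure_image_cell_ge:
  fixes f :: "real \<Rightarrow> real"
  assumes f: "continuous_on {0..1} f" and "i < b"
  shows "ennreal \<bar>f (real (Suc i) / real b) - f (real i / real b)\<bar> \<le> emeasure lborel (f ` cell b i)"
proof -
  define u v where "u = real i / real b" and "v = real (Suc i) / real b"
  have b: "real b > 0" using \<open>i < b\<close> by simp
  have uv: "0 \<le> u" "u < v" "v \<le> 1"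
    using \<open>i < b\<close> by (auto simp: u_def v_def divide_simps)
  have cell: "x \<in> cell b i" if "u \<le> x" "x < v" for x
  proof -
    have "real i \<le> real b * x" "real b * x < real i + 1"
      using that b by (auto simp: u_def v_def field_simps)
    then have "\<lfloor>real b * x\<rfloor> = int i" by linarith
    then show ?thesis using that uv by (auto simp: cell_def)
  qed
  have cont: "continuous_on {u..v} f"
    by (rule continuous_on_subset[OF f]) (use uv in auto)
  have sub: "{min (f u) (f v)<..<max (f u) (f v)} \<subseteq> f ` cell b i"
  proof
    fix y assume y: "y \<in> {min (f u) (f v)<..<max (f u) (f v)}"
    have "\<exists>x. u \<le> x \<and> x \<le> v \<and> f x = y"
    proof (cases "f u \<le> f v")
      case True
      with y uv cont show ?thesis by (intro IVT') auto
    next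
      case False
      with y uv cont show ?thesis by (intro IVT2') auto
    qed
    then obtain x where x: "u \<le> x" "x \<le> v" "f x = y" by blast
    moreover have "x \<noteq> v" using x y by (auto simp: min_def max_def split: if_splits)
    ultimately show "y \<in> f ` cell b i" using cell[of x] by auto
  qed
  have "ennreal \<bar>f v - f u\<bar> = emeasure lborel {min (f u) (f v)<..<max (f u) (f v)}"
    by (subst emeasure_lborel_Ioo) (auto simp: min_def max_def abs_if)
  also have "\<dots> \<le> emeasure lborel (f ` cell b i)"
    by (intro emeasure_mono sub) (simp add: image_cell_borel[OF f])
  finally show ?thesis by (simp add: u_def v_def)
qed

text \<open>
  A cell meets the level set of \<open>y\<close> exactly when \<open>y\<close> lies in the image of the cell. This turns the
  number of cells met into a simple function of \<open>y\<close>.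
\<close>

lemma card_cells_hit:
  fixes f :: "real \<Rightarrow> real"
  shows "finite ((\<lambda>x. \<lfloor>real b * x\<rfloor>) ` {x\<in>{0..1}. f x = y})"
    and "of_nat (card ((\<lambda>x. \<lfloor>real b * x\<rfloor>) ` {x\<in>{0..1}. f x = y}))
      = (\<Sum>i\<le>b. indicator (f ` cell b i) y :: ennreal)"
proof -
  let ?L = "{x\<in>{0..1}. f x = y}"
  have eq: "(\<lambda>x. \<lfloor>real b * x\<rfloor>) ` ?L = int ` {i\<in>{..b}. y \<in> f ` cell b i}"
  proof (intro equalityI subsetI)
    fix k assume "k \<in> (\<lambda>x. \<lfloor>real b * x\<rfloor>) ` ?L"
    then obtain x where x: "0 \<le> x" "x \<le> 1" "f x = y" "k = \<lfloor>real b * x\<rfloor>" by auto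
    have "0 \<le> real b * x" "real b * x \<le> real b"
      using x by (auto simp: mult_left_le)
    then have "0 \<le> k" "k \<le> int b" unfolding x(4) by linarith+
    moreover have "x \<in> cell b (nat k)" using x \<open>0 \<le> k\<close> by (simp add: cell_def)
    ultimately show "k \<in> int ` {i\<in>{..b}. y \<in> f ` cell b i}"
      using x(3) by (intro image_eqI[of _ _ "nat k"]) auto
  next
    fix k assume "k \<in> int ` {i\<in>{..b}. y \<in> f ` cell b i}"
    then show "k \<in> (\<lambda>x. \<lfloor>real b * x\<rfloor>) ` ?L"
      unfolding cell_def by force
  qed
  show "finite ((\<lambda>x. \<lfloor>real b * x\<rfloor>) ` ?L)" unfolding eq by simp
  show "of_nat (card ((\<lambda>x. \<lfloor>real b * x\<rfloor>) ` ?L)) = (\<Sum>i\<le>b. indicator (f ` cell b i) y :: ennreal)"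
    unfolding eq by (simp add: card_image indicator_def sum.If_cases Int_def)
qed

lemma indicatrix_borel_measurable:
  fixes f :: "real \<Rightarrow> real"
  assumes f: "continuous_on {0..1} f"
  shows "(\<lambda>y. ext_card {x\<in>{0..1}. f x = y}) \<in> borel_measurable borel"
proof -
  have "ext_card {x\<in>{0..1}. f x = y} = (SUP n. \<Sum>i\<le>n. indicator (f ` cell n i) y)" for y
    unfolding card_cells_hit(2)[symmetric]
    by (rule ext_card_eq_SUP_floor[OF card_cells_hit(1) filterlim_real_sequentially])
  moreover have "(\<lambda>y. SUP n. \<Sum>i\<le>n. indicator (f ` cell n i) y :: ennreal) \<in> borel_measurable borel"
    using image_cell_borel[OF f] by measurable
  ultimately show ?thesis by simp
qed

text \<open>
  The easy half of Banach's indicatrix theorem, for equidistant partitions.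
\<close>

lemma variation_le_integral_indicatrix:
  fixes f :: "real \<Rightarrow> real"
  assumes f: "continuous_on {0..1} f"
  shows "ennreal (\<Sum>i<b. \<bar>f (real (Suc i) / real b) - f (real i / real b)\<bar>)
    \<le> (\<integral>\<^sup>+ y. ext_card {x\<in>{0..1}. f x = y} \<partial>lborel)"
proof -
  have "ennreal (\<Sum>i<b. \<bar>f (real (Suc i) / real b) - f (real i / real b)\<bar>)
      = (\<Sum>i<b. ennreal \<bar>f (real (Suc i) / real b) - f (real i / real b)\<bar>)"
    by simp
  also have "\<dots> \<le> (\<Sum>i<b. emeasure lborel (f ` cell b i))"
    by (intro sum_mono emeasure_image_cell_ge[OF f]) auto
  also have "\<dots> \<le> (\<Sum>i\<le>b. emeasure lborel (f ` cell b i))"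
    by (intro sum_mono2) auto
  also have "\<dots> = (\<integral>\<^sup>+ y. (\<Sum>i\<le>b. indicator (f ` cell b i) y) \<partial>lborel)"
    using image_cell_borel[OF f] by (subst nn_integral_sum) auto
  also have "\<dots> \<le> (\<integral>\<^sup>+ y. ext_card {x\<in>{0..1}. f x = y} \<partial>lborel)"
    unfolding card_cells_hit(2)[symmetric] by (intro nn_integral_mono card_image_le_ext_card)
  finally show ?thesis .
qed

section \<open>The expected cardinality of a level set\<close>

theorem theorem4p1:
  fixes r :: nat and P :: "'w measure" and Y :: "'w \<Rightarrow> real"
  assumes "r \<ge> 2" and "even r"
    and "prob_space P"
    and "Y \<in> borel_measurable P"
    and "distr P lborel Y = uniform_measure lborel {0..takagi_max r}"
  shows "(\<lambda>y. ext_card (level_set r y)) \<in> borel_measurable borel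
    \<and> (\<integral>\<^sup>+ \<omega>. ext_card (level_set r (Y \<omega>)) \<partial>P)
        = ennreal ((2 * (real r)\<^sup>2 - 2) / (real r)\<^sup>2)
          * (\<integral>\<^sup>+ y \<in> {0..(real r)\<^sup>2 / (2 * (real r)\<^sup>2 - 2)}. ext_card (level_set r y) \<partial>lborel)
    \<and> (\<integral>\<^sup>+ \<omega>. ext_card (level_set r (Y \<omega>)) \<partial>P) = \<infinity>"
proof -
  obtain h where h: "r = 2 * h" "h > 0" using assms(1,2) by (auto elim!: evenE)
  have cont: "continuous_on {0..1} (takagi r)" by (rule continuous_on_takagi[OF assms(1)])
  have meas: "(\<lambda>y. ext_card (level_set r y)) \<in> borel_measurable borel"
    unfolding level_set_def by (rule indicatrix_borel_measurable[OF cont])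
  let ?I = "\<integral>\<^sup>+ y \<in> {0..takagi_max r}. ext_card (level_set r y) \<partial>lborel"
  have "(real r)\<^sup>2 > 1"
    using assms(1) by (simp add: power2_eq_square less_1_mult)
  then have M: "takagi_max r > 0" and
    M': "1 / takagi_max r = (2 * (real r)\<^sup>2 - 2) / (real r)\<^sup>2"
    using assms(1) by (auto simp: takagi_max_def intro!: divide_pos_pos)
  have Y: "Y \<in> measurable P lborel" using assms(4) by simp
  have "(\<integral>\<^sup>+ \<omega>. ext_card (level_set r (Y \<omega>)) \<partial>P)
      = (\<integral>\<^sup>+ y. ext_card (level_set r y) \<partial>distr P lborel Y)"
    using Y meas by (subst nn_integral_distr) auto
  also have "\<dots> = ?I / emeasure lborel {0..takagi_max r}"
    unfolding assms(5) using meas by (subst nn_integral_uniform_measure) auto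
  also have "emeasure lborel {0..takagi_max r} = ennreal (takagi_max r)"
    using M by simp
  also have "?I / ennreal (takagi_max r) = ennreal (1 / takagi_max r) * ?I"
    using M by (simp add: divide_ennreal_def inverse_ennreal inverse_eq_divide mult.commute)
  finally have E: "(\<integral>\<^sup>+ \<omega>. ext_card (level_set r (Y \<omega>)) \<partial>P) = ennreal (1 / takagi_max r) * ?I" .
  have "ext_card (level_set r y) = 0" if "y \<notin> {0..takagi_max r}" for y
  proof -
    have "level_set r y = {}"
      using that takagi_nonneg[OF assms(1)] takagi_le_max[OF assms(1,2)] by (auto simp: level_set_def)
    then show ?thesis by (simp add: ext_card_def)
  qed
  then have I: "?I = (\<integral>\<^sup>+ y. ext_card {x\<in>{0..1}. takagi r x = y} \<partial>lborel)"
    unfolding level_set_def[symmetric] by (intro nn_integral_cong) (auto simp: indicator_def)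
  have "of_nat k \<le> ?I" for k
  proof -
    have "real k \<le> real (2 * Suc k) / 2" by simp
    also note takagi_variation[OF h, of "2 * Suc k"]
    also have "ennreal (\<Sum>j<r ^ (2 * Suc k)\<^sup>2. \<bar>takagi r (real (Suc j) / real r ^ (2 * Suc k)\<^sup>2)
        - takagi r (real j / real r ^ (2 * Suc k)\<^sup>2)\<bar>) \<le> ?I"
      unfolding I using variation_le_integral_indicatrix[OF cont, of "r ^ (2 * Suc k)\<^sup>2"]
      by (simp only: of_nat_power)
    finally show ?thesis by (simp add: ennreal_of_nat_eq_real_of_nat ennreal_leI)
  qed
  then have inf: "?I = \<infinity>"
    unfolding infinity_ennreal_def by (rule ennreal_eq_top_if_of_nat_le)
  moreover have "ennreal (1 / takagi_max r) * \<infinity> = \<infinity>"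
    using M by (simp add: ennreal_mult_top)
  ultimately show ?thesis
    using meas E unfolding M' by (simp add: takagi_max_def)
qed

end
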